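(* Let $C\subseteq\mathbb{R}^n$ be a non-empty closed set, let $f:C\to\mathbb{R}$ be lower semicontinuous on $C$, and let $M>0$ be arbitrary. Define $$F(x)=\min_{y\in\pi_C(x)}f(y)+M\,d_C(x),\qquad x\in\mathbb{R}^n .$$ Then the constrained problem $\min_{x\in C}f(x)$ and the unconstrained problem $\min_{x\in\mathbb{R}^n}F(x)$ are equivalent, i.e. each local (respectively global) minimum point of one problem is a local (respectively global) minimum point of the other, and the values of the two objective functions at the corresponding minimum points coincide.
   Context: $\mathbb{R}^n$ is $n$-dimensional Euclidean space with Euclidean norm $\|\cdot\|$, and $d(x,y)=\|x-y\|$. For a non-empty closed set $C\subseteq\mathbb{R}^n$, $d_C(x)=\min_{y\in C}\|x-y\|$ is the distance from $x$ to $C$ and $\pi_C(x)=\{y\in C:\|x-y\|=d_C(x)\}$ is the (possibly multivalued) Euclidean projection, which is a non-empty compact subset of $C$ (so the minimum of $f$ over $\pi_C(x)$ is attained). A local minimum point of $f$ on $C$ is a point $x^*\in C$ such that $f(x)\ge f(x^* )$ for all $x\in C\cap V$ for some neighborhood $V$ of $x^*$ in $\mathbb{R}^n$; a local minimum point of $F$ is understood over $\mathbb{R}^n$. *)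

theory Defs
  imports "HOL-Analysis.Analysis"
begin

text \<open>
  A function \<open>f : C \<rightarrow> \<real>\<close> is represented by a total function whose values outside \<open>C\<close> are
  irrelevant: every definition below only evaluates \<open>f\<close> at points of \<open>C\<close>.
\<close>

definition lower_semicontinuous_on :: "'a::topological_space set \<Rightarrow> ('a \<Rightarrow> real) \<Rightarrow> bool" where
  "lower_semicontinuous_on C f \<longleftrightarrow>
     (\<forall>x\<in>C. \<forall>a. a < f x \<longrightarrow> (\<forall>\<^sub>F y in at x within C. a < f y))"

definition proj_set :: "'a::metric_space set \<Rightarrow> 'a \<Rightarrow> 'a set" where
  "proj_set C x = {y \<in> C. dist x y = infdist x C}"

text \<open>
  \<open>LEAST v. v \<in> A\<close> is the minimum of \<open>A\<close>, meaningful whenever it is attained; \<open>Min\<close> would be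
  wrong here because the projection set may be infinite.
  For closed non-empty \<open>C\<close> the projection set is non-empty and compact, so a lower
  semicontinuous \<open>f\<close> attains its minimum on it.
\<close>

definition penalty :: "'a::metric_space set \<Rightarrow> ('a \<Rightarrow> real) \<Rightarrow> real \<Rightarrow> 'a \<Rightarrow> real" where
  "penalty C f M x = (LEAST v. v \<in> f ` proj_set C x) + M * infdist x C"

definition local_min_point_on :: "'a::topological_space set \<Rightarrow> ('a \<Rightarrow> real) \<Rightarrow> 'a \<Rightarrow> bool" where
  "local_min_point_on C f x \<longleftrightarrow>
     x \<in> C \<and> (\<exists>V. open V \<and> x \<in> V \<and> (\<forall>y\<in>C \<inter> V. f x \<le> f y))"

definition global_min_point_on :: "'a set \<Rightarrow> ('a \<Rightarrow> real) \<Rightarrow> 'a \<Rightarrow> bool" where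
  "global_min_point_on C f x \<longleftrightarrow> x \<in> C \<and> (\<forall>y\<in>C. f x \<le> f y)"

end

theory Submission
  imports Defs
begin

text \<open>
  On \<open>C\<close> the penalty function \<open>F\<close> agrees with \<open>f\<close>, and for every \<open>x\<close> there is a projection \<open>y\<close> of
  \<open>x\<close> with \<open>F x = f y + M * infdist x C\<close>, since a lower semicontinuous function attains its minimum
  on the compact projection set (\<open>penalty_attained\<close>).

  A minimum of \<open>f\<close> on \<open>C\<close> is a minimum of \<open>F\<close> because \<open>F z \<ge> f y\<close> for a projection \<open>y\<close> of \<open>z\<close>, and
  projections of points close to \<open>x \<in> C\<close> are close to \<open>x\<close>.  Conversely, \<open>F\<close> has no local minimum
  outside \<open>C\<close> (\<open>local_min_penalty_in_set\<close>): if \<open>y\<close> is a projection of \<open>x \<notin> C\<close> realising \<open>F x\<close>, then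
  moving from \<open>x\<close> towards \<open>y\<close> keeps \<open>y\<close> a projection while strictly shrinking the distance
  to \<open>C\<close>, so \<open>F\<close> strictly decreases, for any \<open>M > 0\<close>.
\<close>

lemma lower_semicontinuous_on_attains_min:
  assumes lsc: "lower_semicontinuous_on C f" and "compact K" "K \<subseteq> C" "K \<noteq> {}"
  obtains y where "y \<in> K" "\<And>z. z \<in> K \<Longrightarrow> f y \<le> f z"
proof (rule ccontr)
  assume "\<not> thesis"
  then have "\<forall>x\<in>K. \<exists>y\<in>K. f y < f x"
    using that by (metis not_le)
  then obtain g where g: "\<And>x. x \<in> K \<Longrightarrow> g x \<in> K \<and> f (g x) < f x"
    by metis
  have "\<exists>W. open W \<and> x \<in> W \<and> (\<forall>z\<in>W \<inter> C. f (g x) < f z)" if x: "x \<in> K" for x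
  proof -
    have "\<forall>\<^sub>F z in at x within C. f (g x) < f z"
      using lsc x g[OF x] \<open>K \<subseteq> C\<close> unfolding lower_semicontinuous_on_def by blast
    then obtain W where "open W" "x \<in> W" "\<forall>z\<in>W. z \<noteq> x \<longrightarrow> z \<in> C \<longrightarrow> f (g x) < f z"
      unfolding eventually_at_topological by auto
    then show ?thesis
      using g[OF x] by (metis IntD1 IntD2)
  qed
  then obtain W where W: "\<And>x. x \<in> K \<Longrightarrow> open (W x)" "\<And>x. x \<in> K \<Longrightarrow> x \<in> W x"
      "\<And>x z. x \<in> K \<Longrightarrow> z \<in> W x \<Longrightarrow> z \<in> C \<Longrightarrow> f (g x) < f z"
    by (metis IntI)
  have "K \<subseteq> (\<Union>x\<in>K. W x)"
    using W(2) by blast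
  with \<open>compact K\<close> W(1) obtain D where D: "D \<subseteq> K" "finite D" "K \<subseteq> (\<Union>x\<in>D. W x)"
    by (rule compactE_image)
  then have "D \<noteq> {}"
    using \<open>K \<noteq> {}\<close> by auto
  \<comment> \<open>The lowest of the finitely many points \<open>g x\<close> is itself covered, which yields a lower one.\<close>
  then obtain x where x: "x \<in> D" "\<forall>x'\<in>D. f (g x) \<le> f (g x')"
    using \<open>finite D\<close> ex_min_if_finite[of "(\<lambda>x. f (g x)) ` D"] by (force simp: not_less)
  have "g x \<in> K"
    using g x(1) D(1) by blast
  then obtain x' where "x' \<in> D" "g x \<in> W x'"
    using D(3) by blast
  then have "f (g x') < f (g x)"
    using W(3) D(1) \<open>K \<subseteq> C\<close> \<open>g x \<in> K\<close> by blast
  then show False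
    using x(2) \<open>x' \<in> D\<close> by force
qed

lemma penalty_attained:
  fixes C :: "'a::heine_borel set"
  assumes "closed C" "C \<noteq> {}" "lower_semicontinuous_on C f"
  obtains y where "y \<in> proj_set C x" "\<And>z. z \<in> proj_set C x \<Longrightarrow> f y \<le> f z"
    "penalty C f M x = f y + M * infdist x C"
proof -
  have eq: "proj_set C x = C \<inter> cball x (infdist x C)"
  proof (intro set_eqI iffI)
    fix y assume "y \<in> C \<inter> cball x (infdist x C)"
    then have "y \<in> C" "dist x y \<le> infdist x C"
      by simp_all
    with infdist_le[OF this(1), of x] show "y \<in> proj_set C x"
      by (simp add: proj_set_def)
  qed (simp add: proj_set_def)
  have "compact (proj_set C x)"
    unfolding eq using \<open>closed C\<close> by (intro closed_Int_compact compact_cball)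
  moreover have "proj_set C x \<noteq> {}"
    using infdist_attains_inf[OF assms(1,2), of x] unfolding proj_set_def
    by (metis (mono_tags, lifting) empty_iff mem_Collect_eq)
  moreover have "proj_set C x \<subseteq> C"
    by (auto simp: proj_set_def)
  ultimately obtain y where y: "y \<in> proj_set C x" "\<And>z. z \<in> proj_set C x \<Longrightarrow> f y \<le> f z"
    using lower_semicontinuous_on_attains_min[OF assms(3)] by blast
  then have "(LEAST v. v \<in> f ` proj_set C x) = f y"
    by (intro Least_equality) auto
  then show thesis
    using that[OF y] by (simp add: penalty_def)
qed

lemma penalty_eq_on_set:
  assumes "x \<in> C"
  shows "penalty C f M x = f x"
proof -
  have "proj_set C x = {x}"
    using assms by (auto simp: proj_set_def)
  then show ?thesis
    using assms by (simp add: penalty_def Least_equality)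
qed

lemma local_min_penalty_in_set:
  fixes C :: "'a::{real_normed_vector, heine_borel} set"
  assumes C: "closed C" "C \<noteq> {}" "lower_semicontinuous_on C f" and "M > 0"
    and min: "local_min_point_on UNIV (penalty C f M) x"
  shows "x \<in> C"
proof (rule ccontr)
  assume "x \<notin> C"
  then have d: "infdist x C > 0"
    using C by (simp add: infdist_pos_not_in_closed)
  obtain y where y: "y \<in> C" "dist x y = infdist x C" "penalty C f M x = f y + M * infdist x C"
    using penalty_attained[OF C, of x M] by (metis (mono_tags, lifting) mem_Collect_eq proj_set_def)
  obtain e where e: "e > 0" "\<And>z. dist z x < e \<Longrightarrow> penalty C f M x \<le> penalty C f M z"
    using min unfolding local_min_point_on_def open_dist by fastforce
  \<comment> \<open>The step \<open>t\<close> towards \<open>y\<close> has length \<open>t * infdist x C < e\<close>.\<close>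
  define t where "t = min 1 (e / (2 * infdist x C))"
  have t: "0 < t" "t \<le> 1"
    using e(1) d by (auto simp: t_def)
  have "t * infdist x C \<le> e / (2 * infdist x C) * infdist x C"
    using d by (intro mult_right_mono) (auto simp: t_def)
  then have te: "t * infdist x C < e"
    using e(1) d by simp
  define z where "z = x + t *\<^sub>R (y - x)"
  have zx: "dist z x = t * infdist x C"
    using t y(2) by (simp add: z_def dist_norm norm_minus_commute)
  have "z - y = (1 - t) *\<^sub>R (x - y)"
    by (simp add: z_def algebra_simps)
  then have zy: "dist z y = (1 - t) * infdist x C"
    using t y(2) by (simp add: dist_norm)
  have "infdist x C \<le> infdist z C + dist x z"
    by (rule infdist_triangle)
  moreover have "infdist z C \<le> dist z y"
    using y(1) by (rule infdist_le)
  ultimately have iz: "infdist z C = (1 - t) * infdist x C"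
    using zx zy by (simp add: algebra_simps dist_commute)
  have "y \<in> proj_set C z"
    using y(1) zy iz by (simp add: proj_set_def)
  then have "penalty C f M z \<le> f y + M * infdist z C"
    using penalty_attained[OF C, of z M] by (metis add_right_mono)
  also have "\<dots> < f y + M * infdist x C"
    using iz t d \<open>M > 0\<close> by simp
  finally show False
    using e(2)[of z] zx te y(3) by simp
qed

lemma local_min_point_on_penalty_iff:
  fixes C :: "'a::{real_normed_vector, heine_borel} set"
  assumes C: "closed C" "C \<noteq> {}" "lower_semicontinuous_on C f" and "M > 0"
  shows "local_min_point_on C f x \<longleftrightarrow> local_min_point_on UNIV (penalty C f M) x"
proof
  assume "local_min_point_on C f x"
  then obtain e where e: "x \<in> C" "e > 0" "\<And>y. y \<in> C \<Longrightarrow> dist y x < e \<Longrightarrow> f x \<le> f y"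
    unfolding local_min_point_on_def open_dist by fastforce
  have "penalty C f M x \<le> penalty C f M z" if z: "z \<in> ball x (e / 2)" for z
  proof -
    obtain y where y: "y \<in> C" "dist z y = infdist z C"
        "penalty C f M z = f y + M * infdist z C"
      using penalty_attained[OF C, of z M] by (metis (mono_tags, lifting) mem_Collect_eq proj_set_def)
    \<comment> \<open>Since \<open>x\<close> itself competes for the distance from \<open>z\<close>, \<open>y\<close> is at most twice as far from \<open>x\<close>
      as \<open>z\<close> is.\<close>
    have "dist z y \<le> dist z x"
      using y(2) infdist_le[OF e(1)] by simp
    then have "dist y x < e"
      using z dist_triangle[of y x z] by (simp add: dist_commute)
    then have "f x \<le> f y"
      using e(3) y(1) by blast
    also have "\<dots> \<le> penalty C f M z"
      using y(3) \<open>M > 0\<close> by (simp add: infdist_nonneg)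
    finally show ?thesis
      using penalty_eq_on_set[OF e(1)] by metis
  qed
  then show "local_min_point_on UNIV (penalty C f M) x"
    unfolding local_min_point_on_def using e(2)
    by (intro conjI UNIV_I exI[of _ "ball x (e / 2)"]) auto
next
  assume min: "local_min_point_on UNIV (penalty C f M) x"
  then have "x \<in> C"
    by (rule local_min_penalty_in_set[OF C \<open>M > 0\<close>])
  with min show "local_min_point_on C f x"
    unfolding local_min_point_on_def by (metis IntD1 IntD2 IntI UNIV_I penalty_eq_on_set)
qed

lemma global_min_point_on_penalty_iff:
  fixes C :: "'a::{real_normed_vector, heine_borel} set"
  assumes C: "closed C" "C \<noteq> {}" "lower_semicontinuous_on C f" and "M > 0"
  shows "global_min_point_on C f x \<longleftrightarrow> global_min_point_on UNIV (penalty C f M) x"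
proof
  assume min: "global_min_point_on C f x"
  have "penalty C f M x \<le> penalty C f M z" for z
  proof -
    obtain y where y: "y \<in> C" "penalty C f M z = f y + M * infdist z C"
      using penalty_attained[OF C, of z M] by (metis (mono_tags, lifting) mem_Collect_eq proj_set_def)
    have "f x \<le> f y"
      using min y(1) by (simp add: global_min_point_on_def)
    also have "\<dots> \<le> penalty C f M z"
      using y(2) \<open>M > 0\<close> by (simp add: infdist_nonneg)
    finally show ?thesis
      using min penalty_eq_on_set by (metis global_min_point_on_def)
  qed
  then show "global_min_point_on UNIV (penalty C f M) x"
    by (simp add: global_min_point_on_def)
next
  assume min: "global_min_point_on UNIV (penalty C f M) x"
  then have "local_min_point_on UNIV (penalty C f M) x"
    unfolding global_min_point_on_def local_min_point_on_def by blast
  then have "x \<in> C"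
    by (rule local_min_penalty_in_set[OF C \<open>M > 0\<close>])
  with min show "global_min_point_on C f x"
    unfolding global_min_point_on_def by (metis UNIV_I penalty_eq_on_set)
qed

theorem theorem2:
  fixes C :: "(real ^ 'n) set" and f :: "real ^ 'n \<Rightarrow> real" and M :: real
  assumes "closed C" and "C \<noteq> {}"
    and "lower_semicontinuous_on C f"
    and "M > 0"
  shows "(\<forall>x. local_min_point_on C f x \<longleftrightarrow> local_min_point_on UNIV (penalty C f M) x)
    \<and> (\<forall>x. global_min_point_on C f x \<longleftrightarrow> global_min_point_on UNIV (penalty C f M) x)
    \<and> (\<forall>x. local_min_point_on C f x \<longrightarrow> penalty C f M x = f x)
    \<and> (\<forall>x. global_min_point_on C f x \<longrightarrow> penalty C f M x = f x)"
proof (intro conjI allI impI)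
  show "penalty C f M x = f x" if "local_min_point_on C f x" for x
    using that by (simp add: penalty_eq_on_set local_min_point_on_def)
  show "penalty C f M x = f x" if "global_min_point_on C f x" for x
    using that by (simp add: penalty_eq_on_set global_min_point_on_def)
qed (fact local_min_point_on_penalty_iff[OF assms] global_min_point_on_penalty_iff[OF assms])+

end
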